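(* For $\theta\in\mathbb R$, $\theta\neq0$, let $\bar c(\theta)=\sqrt{1-1/\theta^2}$ if $|\theta|>1$ and $\bar c(\theta)=0$ if $|\theta|\le1$, and let $\bar s(\theta)=\sqrt{1-\bar c^{\,2}(\theta)}$. For $\vartheta\in\mathbb R$ and $\star\in\{F,O,N\}$ put $$\overline{\mathcal L}_\star(\theta,\vartheta)=\left\|\begin{bmatrix}\theta-\vartheta\bar c^{\,2}(\theta)&-\vartheta\bar c(\theta)\bar s(\theta)\\-\vartheta\bar c(\theta)\bar s(\theta)&-\vartheta\bar s^{\,2}(\theta)\end{bmatrix}\right\|_\star$$ and $\overline{\mathcal L}^1_\star(\theta)=\min_{\vartheta\in\mathbb R}\overline{\mathcal L}_\star(\theta,\vartheta)$. Then the minimum is attained at $\vartheta=\bar\eta^*(\theta|\star)$, where $$\bar\eta^*(\theta|F)=\mathrm{sign}(\theta)(|\theta|-1/|\theta|)_+,\qquad\bar\eta^*(\theta|O)=\theta\cdot1_{\{|\theta|>1\}},\qquad\bar\eta^*(\theta|N)=\mathrm{sign}(\theta)(|\theta|-2/|\theta|)_+,$$ and the minimal values are $$[\overline{\mathcal L}_F^1(\theta)]^2=\begin{cases}2-1/\theta^2&|\theta|>1\\\theta^2&|\theta|\le1\end{cases},\quad\overline{\mathcal L}_O^1(\theta)=\begin{cases}1&|\theta|>1\\|\theta|&|\theta|\le1\end{cases},\quad\overline{\mathcal L}_N^1(\theta)=\begin{cases}2\sqrt{1-1/\theta^2}&|\theta|>\sqrt2\\|\theta|&|\theta|\le\sq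rt2\end{cases}.$$
   Context: $\|\cdot\|_F,\|\cdot\|_O,\|\cdot\|_N$ denote the Frobenius, operator (spectral) and nuclear matrix norms. $x_+=\max(x,0)$. The function $\overline{\mathcal L}_\star(\theta,\vartheta)$ is the asymptotic loss $\|\Theta-\widehat\Theta_\eta\|_\star$ of eigenvalue shrinkage in the rank-one spiked Wigner model $Y=\Theta+W/\sqrt n$ with signal eigenvalue $\theta$, when the shrunken eigenvalue converges to $\vartheta$; $\overline{\mathcal L}^1_\star$ and $\bar\eta^*(\cdot|\star)$ are called the formally optimal asymptotic loss and a formally optimal shrinker. *)

theory Defs
  imports "HOL-Analysis.Analysis" "HOL-Computational_Algebra.Polynomial"
begin

definition charpoly :: "real ^ 'n ^ 'n \<Rightarrow> real poly" where
  "charpoly A = det (\<chi> i j. (if i = j then [:0, 1:] else 0) - [:A $ i $ j:])"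

text \<open>Square roots of the eigenvalues of the Gram matrix, with multiplicity. That matrix is
  symmetric positive semidefinite, so its characteristic polynomial splits over the reals with
  nonnegative roots, and no root is lost in \<^term>\<open>proots\<close>.\<close>

definition singular_values :: "real ^ 'n ^ 'm \<Rightarrow> real multiset" where
  "singular_values A = image_mset sqrt (proots (charpoly (transpose A ** A)))"

definition nuclear_norm :: "real ^ 'n ^ 'm \<Rightarrow> real" where
  "nuclear_norm A = \<Sum>\<^sub># (singular_values A)"

definition operator_norm :: "real ^ 'n ^ 'm \<Rightarrow> real" where
  "operator_norm A = onorm (\<lambda>x. A *v x)"

text \<open>The library norm on \<^typ>\<open>real ^ 'n ^ 'm\<close> is the Euclidean norm of the vector of Euclidean
  row norms.\<close>

definition frobenius_norm :: "real ^ 'n ^ 'm \<Rightarrow> real" where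
  "frobenius_norm A = norm A"

datatype norm_kind = Frobenius | Operator | Nuclear

fun matrix_norm :: "norm_kind \<Rightarrow> real ^ 'n ^ 'm \<Rightarrow> real" where
  "matrix_norm Frobenius A = frobenius_norm A"
| "matrix_norm Operator A = operator_norm A"
| "matrix_norm Nuclear A = nuclear_norm A"

definition c_bar :: "real \<Rightarrow> real" where
  "c_bar \<theta> = (if \<bar>\<theta>\<bar> > 1 then sqrt (1 - 1 / \<theta>\<^sup>2) else 0)"

definition s_bar :: "real \<Rightarrow> real" where
  "s_bar \<theta> = sqrt (1 - (c_bar \<theta>)\<^sup>2)"

definition loss_matrix :: "real \<Rightarrow> real \<Rightarrow> real ^ 2 ^ 2" where
  "loss_matrix \<theta> \<eta> = vector
     [vector [\<theta> - \<eta> * (c_bar \<theta>)\<^sup>2, - \<eta> * c_bar \<theta> * s_bar \<theta>],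
      vector [- \<eta> * c_bar \<theta> * s_bar \<theta>, - \<eta> * (s_bar \<theta>)\<^sup>2]]"

definition asymptotic_loss :: "norm_kind \<Rightarrow> real \<Rightarrow> real \<Rightarrow> real" where
  "asymptotic_loss k \<theta> \<eta> = matrix_norm k (loss_matrix \<theta> \<eta>)"

text \<open>\<^const>\<open>Least\<close> is an honest minimum: it is specified only if the infimum is attained.\<close>

definition optimal_loss :: "norm_kind \<Rightarrow> real \<Rightarrow> real" where
  "optimal_loss k \<theta> = (LEAST l. l \<in> range (asymptotic_loss k \<theta>))"

fun optimal_shrinker :: "norm_kind \<Rightarrow> real \<Rightarrow> real" where
  "optimal_shrinker Frobenius \<theta> = sgn \<theta> * max (\<bar>\<theta>\<bar> - 1 / \<bar>\<theta>\<bar>) 0"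
| "optimal_shrinker Operator \<theta> = \<theta> * (if \<bar>\<theta>\<bar> > 1 then 1 else 0)"
| "optimal_shrinker Nuclear \<theta> = sgn \<theta> * max (\<bar>\<theta>\<bar> - 2 / \<bar>\<theta>\<bar>) 0"

end

theory Submission
  imports Defs
begin

text \<open>With \<open>u = (c, s)\<close> the loss matrix is \<open>\<theta> e\<^sub>1 e\<^sub>1\<^sup>T - \<eta> u u\<^sup>T\<close>; it has
  trace \<open>\<theta> - \<eta>\<close> and determinant \<open>- \<eta> \<theta> s\<^sup>2\<close>. For a two-by-two matrix \<open>A\<close> the squared
  nuclear norm is \<open>\<parallel>A\<parallel>\<^sub>F\<^sup>2 + 2 \<bar>det A\<bar>\<close>, so the squared Frobenius and nuclear losses are
  (piecewise) quadratics in \<open>\<eta>\<close>, minimised by completing the square. For the operator norm, the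
  unit vector \<open>(s, -c)\<close> orthogonal to \<open>u\<close> is sent to \<open>\<theta> s e\<^sub>1\<close> for every \<open>\<eta>\<close>, so the loss is at
  least \<open>\<bar>\<theta>\<bar> s\<close>, and the proposed shrinker attains this bound.\<close>

section \<open>Matrix and vector norms in dimension two\<close>

lemma norm_matrix_2_sq:
  fixes A :: "real ^ 2 ^ 2"
  shows "(norm A)\<^sup>2 = (A $ 1 $ 1)\<^sup>2 + (A $ 1 $ 2)\<^sup>2 + (A $ 2 $ 1)\<^sup>2 + (A $ 2 $ 2)\<^sup>2"
  by (simp add: norm_vec_def L2_set_def sum_2)

lemma charpoly_2:
  fixes A :: "real ^ 2 ^ 2"
  shows "charpoly A = [:det A, - trace A, 1:]"
  by (simp add: charpoly_def det_2 trace_def sum_2)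

lemma trace_gram_2:
  fixes A :: "real ^ 2 ^ 2"
  shows "trace (transpose A ** A) = (norm A)\<^sup>2"
  unfolding norm_matrix_2_sq
  by (simp add: trace_def matrix_matrix_mult_def transpose_def sum_2 power2_eq_square)

text \<open>Adding or subtracting \<open>2 * det A\<close> turns the squared norm into a sum of two
  squares. This makes the discriminant of the Gram characteristic polynomial nonnegative.\<close>

lemma two_abs_det_le_norm_sq:
  fixes A :: "real ^ 2 ^ 2"
  shows "2 * \<bar>det A\<bar> \<le> (norm A)\<^sup>2"
proof -
  have "0 \<le> (A$1$1 + A$2$2)\<^sup>2 + (A$1$2 - A$2$1)\<^sup>2" "0 \<le> (A$1$1 - A$2$2)\<^sup>2 + (A$1$2 + A$2$1)\<^sup>2"
    by simp_all
  then show ?thesis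
    unfolding norm_matrix_2_sq det_2 abs_if by (simp add: power2_eq_square algebra_simps)
qed

lemma proots_monic_quadratic:
  fixes r1 r2 :: "'a :: idom"
  shows "proots [:r1 * r2, - (r1 + r2), 1:] = {#r1, r2#}"
proof -
  have "[:r1 * r2, - (r1 + r2), 1:] = [:- r1, 1:] * [:- r2, 1:]" by simp
  moreover have "proots ([:- r1, 1:] * [:- r2, 1:]) = {#r1, r2#}"
    by (subst proots_mult) simp_all
  ultimately show ?thesis by (simp only:)
qed

text \<open>The Gram eigenvalues \<open>r1\<close>, \<open>r2\<close> have sum
  \<open>(norm A)\<^sup>2\<close> and product \<open>(det A)\<^sup>2\<close>; now expand the square
  of \<open>sqrt r1 + sqrt r2\<close>.\<close>

lemma nuclear_norm_nonneg_sq_2: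
  fixes A :: "real ^ 2 ^ 2"
  shows "nuclear_norm A \<ge> 0" and "(nuclear_norm A)\<^sup>2 = (norm A)\<^sup>2 + 2 * \<bar>det A\<bar>"
proof -
  define t d q where "t = (norm A)\<^sup>2" and "d = det A" and "q = sqrt (t\<^sup>2 - 4 * d\<^sup>2)"
  \<comment> \<open>The quadratic formula for the Gram characteristic polynomial, so that it factors
    explicitly and \<open>proots\<close> can be read off.\<close>
  define r1 r2 where "r1 = (t + q) / 2" and "r2 = (t - q) / 2"
  have td: "2 * \<bar>d\<bar> \<le> t" unfolding t_def d_def by (rule two_abs_det_le_norm_sq)
  then have "(2 * \<bar>d\<bar>)\<^sup>2 \<le> t\<^sup>2" by (intro power_mono) auto
  then have disc: "0 \<le> t\<^sup>2 - 4 * d\<^sup>2" by (simp add: power_mult_distrib)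
  then have q2: "q\<^sup>2 = t\<^sup>2 - 4 * d\<^sup>2" and q0: "0 \<le> q" by (simp_all add: q_def)
  have "t \<ge> 0" by (simp add: t_def)
  then have "q \<le> t" using q2 by (intro power2_le_imp_le[of q t]) auto
  then have r: "0 \<le> r1" "0 \<le> r2" using q0 \<open>t \<ge> 0\<close> by (simp_all add: r1_def r2_def)
  have sum: "r1 + r2 = t" by (simp add: r1_def r2_def field_simps)
  have "4 * (r1 * r2) = t\<^sup>2 - q\<^sup>2"
    by (simp add: r1_def r2_def power2_eq_square field_simps)
  then have prod: "r1 * r2 = d\<^sup>2" using q2 by simp
  have "charpoly (transpose A ** A) = [:r1 * r2, - (r1 + r2), 1:]"
    unfolding charpoly_2 trace_gram_2 prod sum
    by (simp add: t_def d_def det_mul det_transpose power2_eq_square)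
  then have nuc: "nuclear_norm A = sqrt r1 + sqrt r2"
    by (simp only: nuclear_norm_def singular_values_def proots_monic_quadratic) simp
  show "nuclear_norm A \<ge> 0" using r nuc by simp
  have "sqrt r1 * sqrt r2 = \<bar>d\<bar>" by (simp flip: real_sqrt_mult add: prod)
  then have "(nuclear_norm A)\<^sup>2 = t + 2 * \<bar>d\<bar>"
    unfolding nuc using r sum by (simp add: power2_sum)
  then show "(nuclear_norm A)\<^sup>2 = (norm A)\<^sup>2 + 2 * \<bar>det A\<bar>" by (simp add: t_def d_def)
qed

lemma norm_le_operator_norm_mult: "norm (A *v x) \<le> operator_norm A * norm x"
  unfolding operator_norm_def by (rule onorm) (rule matrix_vector_mul_bounded_linear)

lemma operator_norm_le:
  assumes "\<And>x. norm (A *v x) \<le> b * norm x"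
  shows "operator_norm A \<le> b"
  unfolding operator_norm_def using assms by (rule onorm_le)

lemma norm_vec_2_sq: "(norm (x :: real ^ 2))\<^sup>2 = (x $ 1)\<^sup>2 + (x $ 2)\<^sup>2"
  by (simp add: norm_vec_def L2_set_def sum_2)

lemma optimal_loss_eqI:
  assumes "is_arg_min (asymptotic_loss k \<theta>) (\<lambda>\<eta>. True) \<eta>"
  shows "optimal_loss k \<theta> = asymptotic_loss k \<theta> \<eta>"
  unfolding optimal_loss_def
  by (rule Least_equality) (use assms in \<open>auto simp: is_arg_min_def not_less\<close>)

section \<open>The weights and the invariants of the loss matrix\<close>

lemma c_bar_sq: "(c_bar \<theta>)\<^sup>2 = (if \<bar>\<theta>\<bar> > 1 then 1 - 1 / \<theta>\<^sup>2 else 0)"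
proof -
  have "1 / \<theta>\<^sup>2 \<le> 1" if "\<bar>\<theta>\<bar> > 1"
    using that by (simp add: divide_le_eq_1 abs_square_less_1 flip: not_less)
  then show ?thesis by (simp add: c_bar_def)
qed

lemma s_bar_sq: "(s_bar \<theta>)\<^sup>2 = (if \<bar>\<theta>\<bar> > 1 then 1 / \<theta>\<^sup>2 else 1)"
  by (simp add: s_bar_def c_bar_sq)

lemma s_bar_sq_gt_1: "\<bar>\<theta>\<bar> > 1 \<Longrightarrow> (s_bar \<theta>)\<^sup>2 = 1 / \<theta>\<^sup>2"
  by (simp add: s_bar_sq)

text \<open>The vector (c, s) is a unit vector; this form is used to eliminate c.\<close>

lemma c_bar_sq_eq: "(c_bar \<theta>)\<^sup>2 = 1 - (s_bar \<theta>)\<^sup>2"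
  by (simp add: c_bar_sq s_bar_sq)

lemma loss_matrix_nth [simp]:
  "loss_matrix \<theta> \<eta> $ 1 $ 1 = \<theta> - \<eta> * (c_bar \<theta>)\<^sup>2"
  "loss_matrix \<theta> \<eta> $ 1 $ 2 = - \<eta> * c_bar \<theta> * s_bar \<theta>"
  "loss_matrix \<theta> \<eta> $ 2 $ 1 = - \<eta> * c_bar \<theta> * s_bar \<theta>"
  "loss_matrix \<theta> \<eta> $ 2 $ 2 = - \<eta> * (s_bar \<theta>)\<^sup>2"
  by (simp_all add: loss_matrix_def)

lemma det_loss_matrix: "det (loss_matrix \<theta> \<eta>) = - (\<eta> * \<theta> * (s_bar \<theta>)\<^sup>2)"
  by (simp add: det_2 power2_eq_square algebra_simps)

text \<open>For a symmetric two-by-two matrix the squared norm is the squared trace minus twice the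
  determinant.\<close>

lemma norm_loss_matrix_sq:
  "(norm (loss_matrix \<theta> \<eta>))\<^sup>2 = (\<theta> - \<eta>)\<^sup>2 + 2 * (\<eta> * \<theta> * (s_bar \<theta>)\<^sup>2)"
  by (simp add: norm_matrix_2_sq power_mult_distrib c_bar_sq_eq) algebra

lemma frobenius_loss_sq:
  "(asymptotic_loss Frobenius \<theta> \<eta>)\<^sup>2 = (\<theta> - \<eta>)\<^sup>2 + 2 * (\<eta> * \<theta> * (s_bar \<theta>)\<^sup>2)"
  by (simp add: asymptotic_loss_def frobenius_norm_def norm_loss_matrix_sq)

text \<open>The last two terms add up when \<eta> and \<theta> have the same sign and cancel when
  the signs are opposite.\<close>

lemma nuclear_loss_sq:
  "(asymptotic_loss Nuclear \<theta> \<eta>)\<^sup>2 =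
     (\<theta> - \<eta>)\<^sup>2 + 2 * (\<eta> * \<theta> * (s_bar \<theta>)\<^sup>2) + 2 * \<bar>\<eta> * \<theta> * (s_bar \<theta>)\<^sup>2\<bar>"
  by (simp add: asymptotic_loss_def nuclear_norm_nonneg_sq_2(2) norm_loss_matrix_sq det_loss_matrix)

section \<open>Operator loss\<close>

lemma abs_mult_s_bar: "\<bar>\<theta>\<bar> * s_bar \<theta> = (if \<bar>\<theta>\<bar> > 1 then 1 else \<bar>\<theta>\<bar>)"
  by (auto simp: s_bar_def c_bar_sq real_sqrt_divide)

lemma s_bar_nonneg: "0 \<le> s_bar \<theta>"
  by (simp add: s_bar_def c_bar_sq)

lemma operator_loss_ge: "\<bar>\<theta>\<bar> * s_bar \<theta> \<le> asymptotic_loss Operator \<theta> \<eta>"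
proof -
  let ?v = "vector [s_bar \<theta>, - c_bar \<theta>] :: real ^ 2"
  have "(loss_matrix \<theta> \<eta> *v ?v) $ 1 = \<theta> * s_bar \<theta>" "(loss_matrix \<theta> \<eta> *v ?v) $ 2 = 0"
    by (simp_all add: matrix_vector_mult_def sum_2 power2_eq_square algebra_simps)
  then have "(norm (loss_matrix \<theta> \<eta> *v ?v))\<^sup>2 = (\<bar>\<theta>\<bar> * s_bar \<theta>)\<^sup>2"
    by (simp add: norm_vec_2_sq power_mult_distrib)
  then have "norm (loss_matrix \<theta> \<eta> *v ?v) = \<bar>\<theta>\<bar> * s_bar \<theta>"
    by (simp add: power2_eq_iff_nonneg s_bar_nonneg)
  moreover have "(norm ?v)\<^sup>2 = 1" by (simp add: norm_vec_2_sq c_bar_sq_eq)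
  then have "norm ?v = 1" by (metis norm_ge_zero power2_eq_1_iff neg_0_le_iff_le not_one_le_zero)
  ultimately show ?thesis
    using norm_le_operator_norm_mult[of "loss_matrix \<theta> \<eta>" ?v] by (simp add: asymptotic_loss_def)
qed

text \<open>If \<open>\<bar>\<theta>\<bar> > 1\<close>, then \<eta> = \<theta> and the loss matrix
  is \<theta> s times the reflection with rows (s, -c) and (-c, -s), so it scales every vector by
  exactly \<open>\<bar>\<theta>\<bar> * s_bar \<theta>\<close>. Otherwise \<eta> = 0 and s = 1, and
  only the entry \<theta> in the corner remains.\<close>

lemma operator_loss_shrinker:
  "asymptotic_loss Operator \<theta> (optimal_shrinker Operator \<theta>) = \<bar>\<theta>\<bar> * s_bar \<theta>"
proof (rule antisym[OF _ operator_loss_ge])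
  let ?M = "loss_matrix \<theta> (optimal_shrinker Operator \<theta>)"
  have "norm (?M *v x) \<le> (\<bar>\<theta>\<bar> * s_bar \<theta>) * norm x" for x
  proof (rule power2_le_imp_le)
    show "0 \<le> (\<bar>\<theta>\<bar> * s_bar \<theta>) * norm x" by (simp add: s_bar_nonneg)
    show "(norm (?M *v x))\<^sup>2 \<le> (\<bar>\<theta>\<bar> * s_bar \<theta> * norm x)\<^sup>2"
    proof (cases "\<bar>\<theta>\<bar> > 1")
      case True
      have "(norm (?M *v x))\<^sup>2 =
          (\<theta> * ((s_bar \<theta>)\<^sup>2 * x $ 1 - c_bar \<theta> * s_bar \<theta> * x $ 2))\<^sup>2
          + (\<theta> * (c_bar \<theta> * s_bar \<theta> * x $ 1 + (s_bar \<theta>)\<^sup>2 * x $ 2))\<^sup>2"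
        using True
        by (simp add: norm_vec_2_sq matrix_vector_mult_def sum_2 c_bar_sq_eq) algebra
      also have "\<dots> = \<theta>\<^sup>2 * (s_bar \<theta>)\<^sup>2 * ((c_bar \<theta>)\<^sup>2 + (s_bar \<theta>)\<^sup>2) * ((x $ 1)\<^sup>2 + (x $ 2)\<^sup>2)"
        by algebra
      also have "\<dots> = (\<bar>\<theta>\<bar> * s_bar \<theta> * norm x)\<^sup>2"
        by (simp add: power_mult_distrib norm_vec_2_sq c_bar_sq_eq)
      finally show ?thesis by simp
    next
      case False
      then show ?thesis
        by (simp add: norm_vec_2_sq matrix_vector_mult_def sum_2 power_mult_distrib s_bar_sq
            algebra_simps)
    qed
  qed
  then show "asymptotic_loss Operator \<theta> (optimal_shrinker Operator \<theta>) \<le> \<bar>\<theta>\<bar> * s_bar \<theta>"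
    unfolding asymptotic_loss_def matrix_norm.simps by (rule operator_norm_le)
qed

text \<open>Lets inequalities between squared losses be passed to the losses themselves.\<close>

lemma asymptotic_loss_nonneg: "0 \<le> asymptotic_loss k \<theta> \<eta>"
proof (cases k)
  case Operator
  have "0 \<le> \<bar>\<theta>\<bar> * s_bar \<theta>" by (simp add: s_bar_nonneg)
  also have "\<dots> \<le> asymptotic_loss Operator \<theta> \<eta>" by (rule operator_loss_ge)
  finally show ?thesis using Operator by simp
qed (simp_all add: asymptotic_loss_def frobenius_norm_def nuclear_norm_nonneg_sq_2)

section \<open>Frobenius loss\<close>

lemma frobenius_loss_ge:
  "(if \<bar>\<theta>\<bar> > 1 then 2 - 1 / \<theta>\<^sup>2 else \<theta>\<^sup>2) \<le> (asymptotic_loss Frobenius \<theta> \<eta>)\<^sup>2"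
proof (cases "\<bar>\<theta>\<bar> > 1")
  case True
  then have "\<theta> \<noteq> 0" by auto
  \<comment> \<open>Completing the square in \<eta>; the vertex is the shrunken value.\<close>
  have "(asymptotic_loss Frobenius \<theta> \<eta>)\<^sup>2 = (\<eta> - (\<theta> - 1 / \<theta>))\<^sup>2 + (2 - 1 / \<theta>\<^sup>2)"
    unfolding frobenius_loss_sq s_bar_sq_gt_1[OF True]
    using \<open>\<theta> \<noteq> 0\<close> by (simp add: field_simps power2_eq_square)
  then show ?thesis using True by simp
next
  case False
  \<comment> \<open>Here s = 1, so the determinant term cancels the cross term of the
    square.\<close>
  then have "(asymptotic_loss Frobenius \<theta> \<eta>)\<^sup>2 = \<theta>\<^sup>2 + \<eta>\<^sup>2"
    by (simp add: frobenius_loss_sq s_bar_sq power2_diff)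
  then show ?thesis using False by simp
qed

text \<open>Removes the signs from a shrinker whose positive part is not clipped.\<close>

lemma sgn_mult_abs_minus:
  fixes \<theta> a :: real
  shows "sgn \<theta> * (\<bar>\<theta>\<bar> - a / \<bar>\<theta>\<bar>) = \<theta> - a / \<theta>"
  by (simp add: sgn_if field_simps)

lemma frobenius_loss_shrinker:
  assumes "\<theta> \<noteq> 0"
  shows "(asymptotic_loss Frobenius \<theta> (optimal_shrinker Frobenius \<theta>))\<^sup>2 =
    (if \<bar>\<theta>\<bar> > 1 then 2 - 1 / \<theta>\<^sup>2 else \<theta>\<^sup>2)"
proof (cases "\<bar>\<theta>\<bar> > 1")
  case True
  have "\<bar>\<theta>\<bar> - 1 / \<bar>\<theta>\<bar> \<ge> 0"
    using True mult_mono[of 1 "\<bar>\<theta>\<bar>" 1 "\<bar>\<theta>\<bar>"] by (simp add: field_simps)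
  then have shrinker: "optimal_shrinker Frobenius \<theta> = \<theta> - 1 / \<theta>"
    using sgn_mult_abs_minus[of \<theta> 1] by simp
  have "(asymptotic_loss Frobenius \<theta> (optimal_shrinker Frobenius \<theta>))\<^sup>2 = 2 - 1 / \<theta>\<^sup>2"
    unfolding frobenius_loss_sq shrinker s_bar_sq_gt_1[OF True]
    using assms by (simp add: field_simps power2_eq_square)
  then show ?thesis using True by simp
next
  case False
  have "\<bar>\<theta>\<bar> - 1 / \<bar>\<theta>\<bar> \<le> 0"
    using False assms mult_mono[of "\<bar>\<theta>\<bar>" 1 "\<bar>\<theta>\<bar>" 1] by (simp add: field_simps)
  then show ?thesis using False by (simp add: frobenius_loss_sq)
qed

section \<open>Nuclear loss\<close>

lemma sqrt_2_less_abs_iff: "sqrt 2 < \<bar>\<theta>\<bar> \<longleftrightarrow> 2 < \<theta>\<^sup>2"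
  by (metis real_sqrt_abs real_sqrt_less_iff)

text \<open>For \<eta> of the same sign as \<theta>, the squared loss has linear term
  \<open>(4 * (s_bar \<theta>)\<^sup>2 - 2) * \<theta> * \<eta>\<close>. The threshold
  \<open>sqrt 2\<close> is where \<open>(s_bar \<theta>)\<^sup>2\<close> equals 1/2 and this
  coefficient changes sign: beyond it a nonzero \<eta> pays off, below it \<eta> = 0 is
  best.\<close>

lemma nuclear_loss_ge:
  assumes "\<theta> \<noteq> 0"
  shows "(if \<bar>\<theta>\<bar> > sqrt 2 then 4 * (1 - 1 / \<theta>\<^sup>2) else \<theta>\<^sup>2) \<le> (asymptotic_loss Nuclear \<theta> \<eta>)\<^sup>2"
    (is "?m \<le> _")
proof (cases "\<eta> * \<theta> \<ge> 0")
  case True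
  then have loss: "(asymptotic_loss Nuclear \<theta> \<eta>)\<^sup>2 = (\<theta> - \<eta>)\<^sup>2 + 4 * (\<eta> * \<theta> * (s_bar \<theta>)\<^sup>2)"
    by (simp add: nuclear_loss_sq)
  show ?thesis
  proof (cases "\<bar>\<theta>\<bar> > sqrt 2")
    case big: True
    then have one: "\<bar>\<theta>\<bar> > 1" using real_sqrt_gt_1_iff[of 2] by linarith
    have "(asymptotic_loss Nuclear \<theta> \<eta>)\<^sup>2 = (\<eta> - (\<theta> - 2 / \<theta>))\<^sup>2 + 4 * (1 - 1 / \<theta>\<^sup>2)"
      unfolding loss s_bar_sq_gt_1[OF one]
      using assms by (simp add: field_simps power2_eq_square)
    then show ?thesis using big by simp
  next
    case False
    then have "\<theta>\<^sup>2 \<le> 2" by (simp add: sqrt_2_less_abs_iff)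
    \<comment> \<open>Enough for the determinant term to outweigh the cross term -2 \<eta> \<theta>
      of the square.\<close>
    then have "1 / 2 \<le> (s_bar \<theta>)\<^sup>2" using assms by (simp add: s_bar_sq field_simps)
    then have "\<eta> * \<theta> * (1 / 2) \<le> \<eta> * \<theta> * (s_bar \<theta>)\<^sup>2" using True by (rule mult_left_mono)
    then have "\<theta>\<^sup>2 + \<eta>\<^sup>2 \<le> (asymptotic_loss Nuclear \<theta> \<eta>)\<^sup>2"
      unfolding loss by (simp add: power2_diff algebra_simps)
    moreover have "\<theta>\<^sup>2 \<le> \<theta>\<^sup>2 + \<eta>\<^sup>2" by simp
    ultimately have "\<theta>\<^sup>2 \<le> (asymptotic_loss Nuclear \<theta> \<eta>)\<^sup>2" by (rule order_trans[rotated])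
    then show ?thesis using False by simp
  qed
next
  case False
  then have "\<eta> * \<theta> * (s_bar \<theta>)\<^sup>2 \<le> 0" by (intro mult_nonpos_nonneg[of "\<eta> * \<theta>"]) auto
  then have "(asymptotic_loss Nuclear \<theta> \<eta>)\<^sup>2 = (\<theta> - \<eta>)\<^sup>2" by (simp add: nuclear_loss_sq)
  moreover have "\<theta>\<^sup>2 \<le> (\<theta> - \<eta>)\<^sup>2"
    using False zero_le_power2[of \<eta>] unfolding power2_diff not_le
    by (simp only: mult.assoc mult.commute[of \<theta> \<eta>])
  \<comment> \<open>For opposite signs the loss only gives the bound
    \<open>\<theta>\<^sup>2\<close>; this identity shows that it dominates the other branch of
    \<open>?m\<close> too.\<close>
  moreover have "\<theta>\<^sup>2 - 4 * (1 - 1 / \<theta>\<^sup>2) = (\<theta> - 2 / \<theta>)\<^sup>2"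
    using assms by (simp add: field_simps power2_eq_square)
  then have "4 * (1 - 1 / \<theta>\<^sup>2) \<le> \<theta>\<^sup>2" by (metis diff_ge_0_iff_ge zero_le_power2)
  ultimately show ?thesis by simp
qed

lemma nuclear_loss_shrinker:
  assumes "\<theta> \<noteq> 0"
  shows "(asymptotic_loss Nuclear \<theta> (optimal_shrinker Nuclear \<theta>))\<^sup>2 =
    (if \<bar>\<theta>\<bar> > sqrt 2 then 4 * (1 - 1 / \<theta>\<^sup>2) else \<theta>\<^sup>2)"
proof (cases "\<bar>\<theta>\<bar> > sqrt 2")
  case True
  then have gt: "\<theta>\<^sup>2 > 2" by (simp add: sqrt_2_less_abs_iff)
  have one: "\<bar>\<theta>\<bar> > 1" using True real_sqrt_gt_1_iff[of 2] by linarith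
  have "\<bar>\<theta>\<bar> - 2 / \<bar>\<theta>\<bar> \<ge> 0"
    using gt assms by (simp add: field_simps power2_eq_square flip: abs_mult)
  then have "optimal_shrinker Nuclear \<theta> = \<theta> - 2 / \<theta>"
    using sgn_mult_abs_minus[of \<theta> 2] by simp
  \<comment> \<open>The product is nonnegative above the threshold, so the absolute value in the
    loss drops out and the determinant term is doubled.\<close>
  moreover have "(\<theta> - 2 / \<theta>) * \<theta> * (s_bar \<theta>)\<^sup>2 = 1 - 2 / \<theta>\<^sup>2"
    unfolding s_bar_sq_gt_1[OF one] using assms by (simp add: field_simps power2_eq_square)
  moreover have "1 - 2 / \<theta>\<^sup>2 \<ge> 0" using gt by (simp add: divide_le_eq)
  ultimately have "(asymptotic_loss Nuclear \<theta> (optimal_shrinker Nuclear \<theta>))\<^sup>2 =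
      (2 / \<theta>)\<^sup>2 + 4 * (1 - 2 / \<theta>\<^sup>2)"
    by (simp only: nuclear_loss_sq) simp
  then show ?thesis using True by (simp add: power_divide)
next
  case False
  then have "\<theta>\<^sup>2 \<le> 2" by (simp add: sqrt_2_less_abs_iff)
  then have "\<bar>\<theta>\<bar> - 2 / \<bar>\<theta>\<bar> \<le> 0"
    using assms by (simp add: field_simps power2_eq_square flip: abs_mult)
  then show ?thesis using False by (simp add: nuclear_loss_sq)
qed

theorem lemma7p2:
  fixes \<theta> :: real
  assumes "\<theta> \<noteq> 0"
  shows "(\<forall>k. is_arg_min (asymptotic_loss k \<theta>) (\<lambda>\<eta>. True) (optimal_shrinker k \<theta>))
    \<and> (optimal_loss Frobenius \<theta>)\<^sup>2 = (if \<bar>\<theta>\<bar> > 1 then 2 - 1 / \<theta>\<^sup>2 else \<theta>\<^sup>2)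
    \<and> optimal_loss Operator \<theta> = (if \<bar>\<theta>\<bar> > 1 then 1 else \<bar>\<theta>\<bar>)
    \<and> optimal_loss Nuclear \<theta> = (if \<bar>\<theta>\<bar> > sqrt 2 then 2 * sqrt (1 - 1 / \<theta>\<^sup>2) else \<bar>\<theta>\<bar>)"
proof -
  have "asymptotic_loss k \<theta> (optimal_shrinker k \<theta>) \<le> asymptotic_loss k \<theta> \<eta>" for k \<eta>
  proof (cases k)
    case Frobenius
    show ?thesis unfolding Frobenius
      by (rule power2_le_imp_le[OF _ asymptotic_loss_nonneg])
        (simp only: frobenius_loss_shrinker[OF assms] frobenius_loss_ge)
  next
    case Operator
    then show ?thesis by (simp only: operator_loss_shrinker operator_loss_ge)
  next
    case Nuclear
    show ?thesis unfolding Nuclear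
      by (rule power2_le_imp_le[OF _ asymptotic_loss_nonneg])
        (simp only: nuclear_loss_shrinker[OF assms] nuclear_loss_ge[OF assms])
  qed
  then have arg_min: "is_arg_min (asymptotic_loss k \<theta>) (\<lambda>\<eta>. True) (optimal_shrinker k \<theta>)" for k
    by (simp add: is_arg_min_def not_less)
  note loss = optimal_loss_eqI[OF arg_min]
  \<comment> \<open>The nuclear value is claimed unsquared, so the root of the squared formula is
    taken, using nonnegativity of the loss.\<close>
  have "optimal_loss Nuclear \<theta> = sqrt ((asymptotic_loss Nuclear \<theta> (optimal_shrinker Nuclear \<theta>))\<^sup>2)"
    by (simp only: loss real_sqrt_abs abs_of_nonneg[OF asymptotic_loss_nonneg])
  also have "\<dots> = (if \<bar>\<theta>\<bar> > sqrt 2 then 2 * sqrt (1 - 1 / \<theta>\<^sup>2) else \<bar>\<theta>\<bar>)"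
    unfolding nuclear_loss_shrinker[OF assms] if_distrib[of sqrt] real_sqrt_mult by simp
  finally have "optimal_loss Nuclear \<theta> = (if \<bar>\<theta>\<bar> > sqrt 2 then 2 * sqrt (1 - 1 / \<theta>\<^sup>2) else \<bar>\<theta>\<bar>)" .
  then show ?thesis
    using arg_min
    by (simp only: loss frobenius_loss_shrinker[OF assms] operator_loss_shrinker
        abs_mult_s_bar) simp
qed

end
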